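(* Let $n=4k$ with $k$ odd, and let $a\in\mathbb{F}_{3^4}\subseteq\mathbb{F}_{3^n}$ satisfy $a^4-a^2-1=0$. Let $a_1=a$, $a_2=a^5$ if $k\equiv 1\pmod 4$, and $a_1=a^5$, $a_2=a$ if $k\equiv 3\pmod 4$. Then $f:\mathbb{F}_{3^n}\to\mathbb{F}_3$, $f(x)=\operatorname{Tr}_n\big(a_1x^{2(3^k+1)}+a_2x^{(3^k+1)^2}\big)$, is a regular bent function of algebraic degree four belonging to the Maiorana–McFarland class.
   Context: $\operatorname{Tr}_n(x)=\sum_{i=0}^{n-1}x^{3^i}$. With $\omega=e^{2\pi i/3}$, $S_f(b)=\sum_{x\in\mathbb{F}_{3^n}}\omega^{f(x)-\operatorname{Tr}_n(bx)}$; $f$ is bent if $|S_f(b)|^2=3^n$ for all $b$, and regular bent if for all $b$, $3^{-n/2}S_f(b)=\omega^{f^*(b)}$ for some $f^*(b)\in\mathbb{F}_3$. Algebraic degree: maximal ternary digit sum of an exponent occurring. The Maiorana–McFarland class consists of functions $f(x,y)=x\cdot\pi(y)+g(y)$ on $\mathbb{F}_3^{2k}\times\mathbb{F}_3^{2k}$ with $\pi$ a permutation of $\mathbb{F}_3^{2k}$ and $g$ arbitrary; a function on $\mathbb{F}_{3^n}$ belongs to it if it has this form under some $\mathbb{F}_3$-linear identification of $\mathbb{F}_{3^n}$ with $\mathbb{F}_3^{2k}\times\mathbb{F}_3^{2k}$. *)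

theory Defs
  imports
    Complex_Main
    "HOL-Library.Numeral_Type"
    "HOL-Number_Theory.Residues"
    "HOL-Computational_Algebra.Polynomial"
    "HOL-Computational_Algebra.Primes"
    "Jordan_Normal_Form.Matrix"
begin

section \<open>The prime field and the trace\<close>

text \<open>The type \<open>3\<close> is the ring of integers modulo \<open>3\<close>, and \<^const>\<open>Rep_bit1\<close> gives the
  representative in \<open>{0, 1, 2}\<close>.\<close>

type_synonym gf3 = 3

text \<open>The inclusion of the prime field; it is a ring homomorphism because all fields below have
  characteristic \<open>3\<close>.\<close>

definition of_gf3 :: "gf3 \<Rightarrow> 'a::ring_1" where
  "of_gf3 c = of_int (Rep_bit1 c)"

text \<open>The absolute trace of a field with \<open>3 ^ n\<close> elements, as an element of \<open>gf3\<close>. The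
  description is justified by \<open>of_gf3_Tr\<close> and \<open>inj_of_gf3\<close> below.\<close>

definition Tr :: "nat \<Rightarrow> 'a::finite_field \<Rightarrow> gf3" where
  "Tr n x = (THE c. of_gf3 c = (\<Sum>i<n. x ^ (3 ^ i)))"

lemma UNIV_gf3: "(UNIV :: gf3 set) = {0, 1, 2}"
proof (rule card_subset_eq[symmetric])
  have "(0::gf3) \<noteq> 1" "(0::gf3) \<noteq> 2" "(1::gf3) \<noteq> 2"
    by (simp_all add: bit1.Rep_inject_sym bit1.Rep_0 bit1.Rep_1 bit1.Rep_numeral)
  then show "card {0, 1, 2 :: gf3} = CARD(gf3)"
    by simp
qed auto

lemma of_gf3_simps:
  "of_gf3 0 = (0::'a::ring_1)" "of_gf3 1 = (1::'a)" "of_gf3 2 = (2::'a)"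
  by (simp_all add: of_gf3_def bit1.Rep_0 bit1.Rep_1 bit1.Rep_numeral)

lemma CHAR_eq_3:
  assumes "CARD('a::finite_field) = 3 ^ n"
  shows "CHAR('a) = 3"
proof -
  have "CHAR('a) dvd 3 ^ n"
    using CHAR_dvd_CARD[where ?'a = 'a] assms by simp
  moreover have "prime CHAR('a)"
    by simp
  ultimately have "CHAR('a) dvd 3"
    using prime_dvd_power by blast
  then show ?thesis
    using primes_dvd_imp_eq[OF \<open>prime CHAR('a)\<close> _ \<open>CHAR('a) dvd 3\<close>] by simp
qed

lemma inj_of_gf3:
  assumes "CHAR('a::finite_field) = 3"
  shows "inj (of_gf3 :: gf3 \<Rightarrow> 'a)"
proof -
  have 3: "(3::'a) = 0"
    using of_nat_CHAR[where ?'a = 'a] assms by simp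
  then have "(2::'a) = - 1"
    by (simp add: eq_neg_iff_add_eq_0)
  moreover have "(2::'a) \<noteq> 0"
    using of_nat_eq_0_iff_char_dvd[where ?'a = 'a and n = 2] assms by simp
  ultimately have "(0::'a) \<noteq> 2" "(1::'a) \<noteq> 2"
    by (metis, metis add_cancel_left_right one_add_one zero_neq_one)
  note neq = this this[symmetric]
  show ?thesis
  proof (rule injI)
    fix c d :: gf3
    assume eq: "(of_gf3 c :: 'a) = of_gf3 d"
    have "c = 0 \<or> c = 1 \<or> c = 2" "d = 0 \<or> d = 1 \<or> d = 2"
      using UNIV_I[of c] UNIV_I[of d] unfolding UNIV_gf3 by blast+
    then show "c = d"
      using eq neq by (elim disjE) (simp_all only: of_gf3_simps zero_neq_one one_neq_zero)
  qed
qed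

lemma of_gf3_Tr:
  fixes x :: "'a::finite_field"
  assumes card: "CARD('a) = 3 ^ n"
  shows "of_gf3 (Tr n x) = (\<Sum>i<n. x ^ (3 ^ i))"
proof -
  note char = CHAR_eq_3[OF card]
  define s where "s = (\<Sum>i<n. x ^ (3 ^ i))"
  have x: "x ^ (3 ^ n) = x"
    using finite_field_power_card_eq_same[of x] card by simp
  have "s ^ 3 = (\<Sum>i<n. (x ^ (3 ^ i)) ^ 3)"
    unfolding s_def using char by (intro freshmans_dream_sum) simp_all
  also have "\<dots> = (\<Sum>i<n. x ^ (3 ^ Suc i))"
    by (simp add: power_mult[symmetric] mult.commute)
  also have "\<dots> = (\<Sum>i<Suc n. x ^ (3 ^ i)) - x"
    by (subst sum.lessThan_Suc_shift) simp
  also have "\<dots> = s"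
    using x by (simp add: s_def)
  finally have "s * ((s - 1) * (s + 1)) = 0"
    by (simp add: algebra_simps power3_eq_cube)
  then have "s = 0 \<or> s = 1 \<or> s = - 1"
    by (auto simp: eq_neg_iff_add_eq_0)
  moreover have "(- 1 :: 'a) = 2"
    using of_nat_CHAR[where ?'a = 'a] char by (simp add: neg_eq_iff_add_eq_0)
  ultimately have "\<exists>c. of_gf3 c = s"
    by (metis of_gf3_simps)
  then have "\<exists>!c. of_gf3 c = s"
    using inj_of_gf3[OF char] by (auto dest: injD)
  then show ?thesis
    unfolding Tr_def s_def[symmetric] by (rule theI')
qed


section \<open>Bent functions\<close>

definition omega :: complex where
  "omega = exp (2 * of_real pi * \<i> / 3)"

definition omega_pow :: "gf3 \<Rightarrow> complex" where
  "omega_pow c = omega ^ nat (Rep_bit1 c)"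

definition walsh :: "nat \<Rightarrow> ('a::finite_field \<Rightarrow> gf3) \<Rightarrow> 'a \<Rightarrow> complex" where
  "walsh n f b = (\<Sum>x\<in>UNIV. omega_pow (f x - Tr n (b * x)))"

definition bent :: "nat \<Rightarrow> ('a::finite_field \<Rightarrow> gf3) \<Rightarrow> bool" where
  "bent n f \<longleftrightarrow> (\<forall>b. (cmod (walsh n f b))\<^sup>2 = 3 ^ n)"

definition regular_bent :: "nat \<Rightarrow> ('a::finite_field \<Rightarrow> gf3) \<Rightarrow> bool" where
  "regular_bent n f \<longleftrightarrow> bent n f \<and>
     (\<forall>b. \<exists>c. of_real (3 powr (- real n / 2)) * walsh n f b = omega_pow c)"


section \<open>Algebraic degree\<close>

fun ternary_digit_sum :: "nat \<Rightarrow> nat" where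
  "ternary_digit_sum j = (if j = 0 then 0 else j mod 3 + ternary_digit_sum (j div 3))"

declare ternary_digit_sum.simps [simp del]

text \<open>Exponents are read off the reduced univariate representation, i.e. the unique polynomial
  over the big field of degree less than the field size which induces the function.\<close>

definition univariate_rep :: "('a::finite_field \<Rightarrow> gf3) \<Rightarrow> 'a poly" where
  "univariate_rep f = (THE p. degree p < CARD('a) \<and> (\<forall>x. poly p x = of_gf3 (f x)))"

text \<open>The inserted \<open>0\<close> only matters for the zero function.\<close>

definition algebraic_degree :: "('a::finite_field \<Rightarrow> gf3) \<Rightarrow> nat" where
  "algebraic_degree f =
     Max (insert 0 (ternary_digit_sum ` {j. coeff (univariate_rep f) j \<noteq> 0}))"

lemma univariate_rep:
  fixes f :: "'a::finite_field \<Rightarrow> gf3"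
  shows "degree (univariate_rep f) < CARD('a) \<and> (\<forall>x. poly (univariate_rep f) x = of_gf3 (f x))"
proof -
  define q where "q = CARD('a)"
  have q: "q > 1"
    unfolding q_def using card_mono[of UNIV "{0, 1 :: 'a}"] by simp
  define p :: "'a poly" where "p = (\<Sum>a\<in>UNIV. smult (of_gf3 (f a)) (1 - [:- a, 1:] ^ (q - 1)))"
  have pow: "y ^ (q - 1) = (if y = 0 then 0 else 1)" for y :: 'a
  proof (cases "y = 0")
    case False
    have "y * y ^ (q - 1) = y * 1"
      using finite_field_power_card_eq_same[of y] q
      by (simp add: q_def flip: power_Suc)
    then show ?thesis
      using False by simp
  qed (use q in simp)
  have "degree p \<le> q - 1"
    unfolding p_def
    by (intro degree_sum_le order.trans[OF degree_smult_le] degree_diff_le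
        order.trans[OF degree_power_le]) (simp_all)
  moreover have "poly p x = of_gf3 (f x)" for x
  proof -
    have "poly p x = (\<Sum>a\<in>UNIV. if x = a then of_gf3 (f a) else 0)"
      unfolding p_def poly_sum by (intro sum.cong) (simp_all add: pow del: One_nat_def)
    then show ?thesis
      by simp
  qed
  ultimately have "\<exists>p. degree p < CARD('a) \<and> (\<forall>x. poly p x = of_gf3 (f x))"
    using q by (intro exI[of _ p]) (auto simp: q_def)
  then have "\<exists>!p. degree p < CARD('a) \<and> (\<forall>x. poly p x = of_gf3 (f x))"
    by (auto intro!: poly_eqI_degree[where A = UNIV])
  then show ?thesis
    unfolding univariate_rep_def by (rule theI')
qed


section \<open>The Maiorana--McFarland class\<close>

definition MM_function :: "nat \<Rightarrow> (gf3 vec \<times> gf3 vec \<Rightarrow> gf3) \<Rightarrow> bool" where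
  "MM_function m h \<longleftrightarrow> (\<exists>\<pi> g. bij_betw \<pi> (carrier_vec m) (carrier_vec m) \<and>
     (\<forall>x\<in>carrier_vec m. \<forall>y\<in>carrier_vec m. h (x, y) = x \<bullet> \<pi> y + g y))"

definition gf3_linear_identification ::
    "nat \<Rightarrow> ('a::finite_field \<Rightarrow> gf3 vec \<times> gf3 vec) \<Rightarrow> bool" where
  "gf3_linear_identification m \<phi> \<longleftrightarrow>
     bij_betw \<phi> UNIV (carrier_vec m \<times> carrier_vec m) \<and>
     (\<forall>x y. \<phi> (x + y) = (fst (\<phi> x) + fst (\<phi> y), snd (\<phi> x) + snd (\<phi> y))) \<and>
     (\<forall>c x. \<phi> (of_gf3 c * x) = (c \<cdot>\<^sub>v fst (\<phi> x), c \<cdot>\<^sub>v snd (\<phi> x)))"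

definition in_MM_class :: "nat \<Rightarrow> ('a::finite_field \<Rightarrow> gf3) \<Rightarrow> bool" where
  "in_MM_class m f \<longleftrightarrow>
     (\<exists>\<phi> h. gf3_linear_identification m \<phi> \<and> MM_function m h \<and> (\<forall>x. f x = h (\<phi> x)))"


section \<open>Subfields\<close>

text \<open>If \<open>m\<close> divides \<open>n\<close>, a field with \<open>3 ^ n\<close> elements has exactly one subfield with \<open>3 ^ m\<close>
  elements, namely the following set.\<close>

definition GF3_subfield :: "nat \<Rightarrow> 'a::finite_field set" where
  "GF3_subfield m = {x. x ^ (3 ^ m) = x}"

end

(*
  Let q = 3 ^ k and write s for the q-th power map, which has order 4. If k mod 4 = 1 put e = 1,
  otherwise e = - 1. The equation for a gives s (s a1) = - a1 and a2 = e * (a1 + s a1). The field is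
  the direct sum of the spaces U and V on which s o s acts as - e and as e. The trace kills every
  element on which s o s acts as - 1 and is invariant under s; expanding f at u + v with u in U and
  v in V, everything cancels except
    f (u + v) = Tr (p v * u),  where  p v = (a1 - s a1) * v * (s v)^2.
  In characteristic 3 the map p is a bijection from V onto U, and (u, w) |-> Tr (u * w) is a
  nondegenerate pairing on U. This is the Maiorana-McFarland form, and summing characters over U
  gives the Walsh transform. For the degree, every exponent in the expanded trace has ternary digit
  sum 4, and f is nonzero because it is bent.
*)
theory Submission
  imports Defs "Berlekamp_Zassenhaus.Berlekamp_Type_Based"
begin

section \<open>Scalars and characters\<close>

lemma gf3_cases: "c = 0 \<or> c = 1 \<or> c = 2" for c :: gf3
  using UNIV_I[of c] unfolding UNIV_gf3 by blast

lemma three_gf3: "(3::gf3) = 0"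
  by (simp add: bit1.Rep_inject_sym bit1.Rep_0 bit1.Rep_numeral)

lemma gf3_square: "c * c = 1" if "c \<noteq> 0" for c :: gf3
proof -
  have "(2 * 2 :: gf3) = 3 + 1"
    by simp
  also have "\<dots> = 1"
    unfolding three_gf3 by simp
  finally show ?thesis
    using gf3_cases[of c] that by auto
qed

lemma gf3_eq_minus_self: "c = 0" if "c = - c" for c :: gf3
proof -
  have "3 * c = c + c + c"
    by (simp add: algebra_simps)
  also have "c + c = 0"
    using that by (metis add.right_inverse)
  finally show ?thesis
    by (simp add: three_gf3)
qed

lemma Rep_gf3_add: "Rep_bit1 (c + d) = (Rep_bit1 c + Rep_bit1 d) mod 3" for c d :: gf3
  using arg_cong[OF bit1.add_def[of c d], of Rep_bit1] unfolding bit1.Rep_Abs_mod by simp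

lemma Rep_gf3_mult: "Rep_bit1 (c * d) = (Rep_bit1 c * Rep_bit1 d) mod 3" for c d :: gf3
  using arg_cong[OF bit1.mult_def[of c d], of Rep_bit1] unfolding bit1.Rep_Abs_mod by simp

section \<open>The additive character of the prime field\<close>

lemma omega_cubed: "omega ^ 3 = 1"
  using exp_two_pi_i by (simp add: omega_def mult_ac flip: exp_of_nat_mult)

lemma omega_neq_1: "omega \<noteq> 1"
proof -
  have "Im omega = sin (2 * pi / 3)"
    by (simp add: omega_def Im_exp)
  moreover have "sin (2 * pi / 3) > 0"
    by (intro sin_gt_zero) auto
  ultimately show ?thesis
    by auto
qed

lemma cmod_omega: "cmod omega = 1"
  by (simp add: omega_def)

lemma cmod_omega_pow [simp]: "cmod (omega_pow c) = 1"
  by (simp add: omega_pow_def norm_power cmod_omega)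

lemma omega_pow_0 [simp]: "omega_pow 0 = 1"
  by (simp add: omega_pow_def bit1.Rep_0)

lemma omega_power_mod: "omega ^ (m mod 3) = omega ^ m"
proof -
  have "omega ^ m = (omega ^ 3) ^ (m div 3) * omega ^ (m mod 3)"
    by (simp flip: power_mult power_add)
  then show ?thesis
    by (simp add: omega_cubed)
qed

lemma omega_pow_add: "omega_pow (c + d) = omega_pow c * omega_pow d"
proof -
  have "0 \<le> Rep_bit1 c" "0 \<le> Rep_bit1 d"
    using bit1.Rep_less_n[where 'a = num1] Rep_bit1[of c] Rep_bit1[of d] by auto
  then have "nat (Rep_bit1 (c + d)) = (nat (Rep_bit1 c) + nat (Rep_bit1 d)) mod 3"
    by (simp add: Rep_gf3_add nat_mod_distrib nat_add_distrib)
  then show ?thesis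
    by (simp add: omega_pow_def omega_power_mod power_add)
qed

lemma omega_pow_neq_1: "omega_pow c \<noteq> 1" if "c \<noteq> 0"
proof
  assume *: "omega_pow c = 1"
  have "c = 1 \<or> c = 2"
    using gf3_cases[of c] that by blast
  then have "omega = 1"
  proof
    assume "c = 1"
    with * show ?thesis by (simp add: omega_pow_def bit1.Rep_1)
  next
    assume "c = 2"
    with * have "omega ^ 2 = 1" by (simp add: omega_pow_def bit1.Rep_numeral)
    with omega_cubed show ?thesis by (simp add: power3_eq_cube power2_eq_square)
  qed
  with omega_neq_1 show False ..
qed

section \<open>The prime field inside a ring of characteristic three\<close>

lemma of_int_mod_3: "of_int (m mod 3) = (of_int m :: 'a::ring_1)" if "(3::'a) = 0"
proof -
  have "(of_int m :: 'a) = of_int (3 * (m div 3) + m mod 3)"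
    by simp
  also have "\<dots> = of_int (m mod 3)"
    unfolding of_int_add of_int_mult by (simp add: that)
  finally show ?thesis ..
qed

lemma three_eq_0: "(3::'a::ring_1) = 0" if "CHAR('a) = 3"
  using of_nat_CHAR[where ?'a = 'a] that by simp

lemma of_gf3_add: "of_gf3 (c + d) = (of_gf3 c + of_gf3 d :: 'a::ring_1)" if "CHAR('a) = 3"
  by (simp add: of_gf3_def Rep_gf3_add of_int_mod_3 three_eq_0 that)

lemma of_gf3_mult: "of_gf3 (c * d) = (of_gf3 c * of_gf3 d :: 'a::ring_1)" if "CHAR('a) = 3"
  by (simp add: of_gf3_def Rep_gf3_mult of_int_mod_3 three_eq_0 that)

lemma of_gf3_minus: "of_gf3 (- c) = (- of_gf3 c :: 'a::ring_1)" if "CHAR('a) = 3"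
  using of_gf3_add[OF that, of c "- c"] by (simp add: of_gf3_simps eq_neg_iff_add_eq_0 add.commute)

lemma of_gf3_diff: "of_gf3 (c - d) = (of_gf3 c - of_gf3 d :: 'a::ring_1)" if "CHAR('a) = 3"
  using of_gf3_add[OF that, of c "- d"] by (simp add: of_gf3_minus[OF that])

lemma of_gf3_power3: "of_gf3 c ^ 3 = (of_gf3 c :: 'a::finite_field)" if "CHAR('a) = 3"
proof -
  have "c * c * c = c"
    using gf3_square[of c] by (cases "c = 0") auto
  then show ?thesis
    by (simp add: power3_eq_cube flip: of_gf3_mult[OF that])
qed

section \<open>Ternary digits\<close>

lemma ternary_digit_sum_step: "ternary_digit_sum (r + 3 * q) = r + ternary_digit_sum q" if "r < 3"
proof -
  have "ternary_digit_sum 0 = 0"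
    by (simp add: ternary_digit_sum.simps)
  then show ?thesis
    using that by (subst ternary_digit_sum.simps) auto
qed

text \<open>Peeling off the digit of index 0 leaves a shifted expansion, which matches the recursion
  of \<open>ternary_digit_sum\<close>.\<close>

lemma ternary_digit_sum_expansion:
  "ternary_digit_sum (\<Sum>p<m. d p * 3 ^ p) = (\<Sum>p<m. d p)" if "\<And>p. d p < 3"
  using that
proof (induction m arbitrary: d)
  case 0
  show ?case
    by (simp add: ternary_digit_sum.simps)
next
  case (Suc m)
  have "(\<Sum>p<Suc m. d p * 3 ^ p) = d 0 + 3 * (\<Sum>p<m. d (Suc p) * 3 ^ p)"
    by (subst sum.lessThan_Suc_shift) (simp add: sum_distrib_left mult_ac)
  then show ?case
    using Suc.IH[of "\<lambda>p. d (Suc p)"] Suc.prems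
    by (simp add: ternary_digit_sum_step sum.lessThan_Suc_shift del: sum.lessThan_Suc)
qed

lemma ternary_expansion_less: "(\<Sum>p<m. d p * 3 ^ p) < (3::nat) ^ m" if "\<And>p. d p < 3"
proof (induction m)
  case (Suc m)
  have "d m * 3 ^ m \<le> 2 * 3 ^ m"
    using that[of m] by (intro mult_right_mono) auto
  with Suc show ?case
    unfolding sum.lessThan_Suc power_Suc by linarith
qed simp

text \<open>Taking \<open>l = i\<close> covers the exponents \<open>2 * 3 ^ i + 2 * 3 ^ j\<close> of the first monomial.\<close>

definition exponent :: "nat \<Rightarrow> nat \<Rightarrow> nat \<Rightarrow> nat" where
  "exponent i j l = 3 ^ i + 2 * 3 ^ j + 3 ^ l"

text \<open>No carries occur: the digit 2 at \<open>j\<close> stays apart from \<open>i\<close> and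
  \<open>l\<close>, and if \<open>i = l\<close> the two ones merge into another digit 2.\<close>

lemma exponent_digits:
  assumes "i < m" "j < m" "l < m" "j \<noteq> i" "j \<noteq> l"
  shows ternary_digit_sum_exponent: "ternary_digit_sum (exponent i j l) = 4"
    and exponent_less: "exponent i j l < 3 ^ m"
proof -
  define d :: "nat \<Rightarrow> nat" where
    "d p = (if p = i then 1 else 0) + (if p = j then 2 else 0) + (if p = l then 1 else 0)" for p
  have d: "d p < 3" for p
    using assms by (auto simp: d_def)
  have "(\<Sum>p<m. d p * 3 ^ p) = (\<Sum>p<m. if p = i then 3 ^ p else 0)
      + (\<Sum>p<m. if p = j then 2 * 3 ^ p else 0) + (\<Sum>p<m. if p = l then 3 ^ p else 0)"
    unfolding sum.distrib[symmetric] by (intro sum.cong) (auto simp: d_def)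
  then have eq: "exponent i j l = (\<Sum>p<m. d p * 3 ^ p)"
    using assms by (simp add: exponent_def)
  have "(\<Sum>p<m. d p) = 4"
    using assms by (simp add: d_def sum.distrib)
  then show "ternary_digit_sum (exponent i j l) = 4"
    unfolding eq using ternary_digit_sum_expansion[of d m] d by simp
  show "exponent i j l < 3 ^ m"
    unfolding eq using ternary_expansion_less[of d m] d by simp
qed

section \<open>The trace\<close>

text \<open>The type token \<open>ty\<close> ties the locale to the field \<open>'a\<close>, whose
  size is governed by \<open>n\<close>.\<close>

locale ternary_field =
  fixes ty :: "'a::finite_field itself" and n :: nat
  assumes card: "CARD('a) = 3 ^ n"
begin

lemma char: "CHAR('a) = 3"
  using CHAR_eq_3[OF card] .

lemma three_0 [simp]: "(3::'a) = 0"
  using three_eq_0 char .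

lemma of_gf3_inject [simp]: "(of_gf3 c :: 'a) = of_gf3 d \<longleftrightarrow> c = d"
  using inj_of_gf3[OF char] by (auto dest: injD)

lemma frob_add: "(x + y :: 'a) ^ (3 ^ i) = x ^ (3 ^ i) + y ^ (3 ^ i)"
  using freshmans_dream'[of "3 ^ i" i x y] char by simp

lemma frob_minus: "(- x :: 'a) ^ (3 ^ i) = - (x ^ (3 ^ i))"
  by (simp add: power_minus_odd)

lemma frob_diff: "(x - y :: 'a) ^ (3 ^ i) = x ^ (3 ^ i) - y ^ (3 ^ i)"
  using frob_add[of x "- y"] by (simp add: frob_minus)

lemma frob_of_gf3: "(of_gf3 c :: 'a) ^ (3 ^ i) = of_gf3 c"
  by (induction i) (simp_all add: of_gf3_power3[OF char] power_mult mult.commute[of 3])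

text \<open>As \<open>of_gf3\<close> is injective, identities for \<open>Tr\<close> are checked in
  the big field, as identities between power sums.\<close>

lemma Tr_eqI: "Tr n x = c" if "(\<Sum>i<n. (x::'a) ^ (3 ^ i)) = of_gf3 c"
  using that of_gf3_Tr[OF card, of x] by simp

lemma Tr_add: "Tr n (x + y :: 'a) = Tr n x + Tr n y"
  by (rule Tr_eqI) (simp add: of_gf3_add[OF char] of_gf3_Tr[OF card] frob_add sum.distrib)

lemma Tr_scale: "Tr n (of_gf3 c * x :: 'a) = c * Tr n x"
  by (rule Tr_eqI)
    (simp add: of_gf3_mult[OF char] of_gf3_Tr[OF card] power_mult_distrib frob_of_gf3 sum_distrib_left)

lemma Tr_minus: "Tr n (- x :: 'a) = - Tr n x"
  by (rule Tr_eqI) (simp add: of_gf3_minus[OF char] of_gf3_Tr[OF card] frob_minus sum_negf)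

lemma Tr_diff: "Tr n (x - y :: 'a) = Tr n x - Tr n y"
  using Tr_add[of x "- y"] by (simp add: Tr_minus)

lemma Tr_0 [simp]: "Tr n (0 :: 'a) = 0"
  using Tr_add[of 0 0] by simp

lemma Tr_sum: "Tr n (\<Sum>i\<in>A. g i :: 'a) = (\<Sum>i\<in>A. Tr n (g i))"
  by (induction A rule: infinite_finite_induct) (simp_all add: Tr_add)

lemma frob_n [simp]: "(x::'a) ^ (3 ^ n) = x"
  using finite_field_power_card_eq_same[of x] card by simp

text \<open>Cubing permutes the conjugates cyclically: the term gained at the top is
  \<open>x ^ (3 ^ n) = x\<close>, the one lost at the bottom.\<close>

lemma Tr_cube: "Tr n ((x::'a) ^ 3) = Tr n x"
proof (rule Tr_eqI)
  have "(\<Sum>i<n. (x ^ 3) ^ (3 ^ i)) = (\<Sum>i<n. x ^ (3 ^ Suc i))"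
    by (simp add: power_mult)
  also have "\<dots> = (\<Sum>i<Suc n. x ^ (3 ^ i)) - x"
    by (subst sum.lessThan_Suc_shift) simp
  also have "\<dots> = of_gf3 (Tr n x)"
    by (simp add: of_gf3_Tr[OF card])
  finally show "(\<Sum>i<n. (x ^ 3) ^ (3 ^ i)) = of_gf3 (Tr n x)" .
qed

lemma Tr_frob: "Tr n ((x::'a) ^ (3 ^ i)) = Tr n x"
  by (induction i) (simp_all add: Tr_cube power_mult mult.commute[of 3])

lemma n_pos: "n > 0"
proof (rule ccontr)
  assume "\<not> ?thesis"
  then have "CARD('a) = 1" using card by simp
  moreover have "card {0, 1::'a} \<le> CARD('a)" by (intro card_mono) auto
  ultimately show False by simp
qed

text \<open>The trace is a polynomial function of degree at most \<open>3 ^ (n - 1)\<close>, which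
  has too few roots to vanish on all \<open>3 ^ n\<close> elements.\<close>

lemma Tr_nonzero: "\<exists>x::'a. Tr n x \<noteq> 0"
proof (rule ccontr)
  assume "\<not> ?thesis"
  then have Tr: "(\<Sum>i<n. x ^ (3 ^ i)) = 0" for x :: 'a
    using of_gf3_Tr[OF card, of x] by (simp add: of_gf3_simps)
  define p :: "'a poly" where "p = (\<Sum>i<n. monom 1 (3 ^ i))"
  have deg: "degree p \<le> 3 ^ (n - 1)"
    unfolding p_def
    by (intro degree_sum_le) (auto intro!: order.trans[OF degree_monom_le] power_increasing)
  \<comment> \<open>Exponent 1 is \<open>3 ^ 0\<close>, so only the summand \<open>i = 0\<close>
    contributes.\<close>
  have "(\<Sum>i<n. coeff (monom (1::'a) (3 ^ i)) 1) = (\<Sum>i<n. if i = 0 then 1 else 0)"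
    by (intro sum.cong) auto
  then have "coeff p 1 = 1"
    using n_pos by (simp add: p_def coeff_sum)
  then have "p \<noteq> 0" by auto
  moreover have "{x. poly p x = 0} = UNIV"
    using Tr by (simp add: p_def poly_sum poly_monom)
  ultimately have "CARD('a) \<le> degree p"
    using card_poly_roots_bound[of p] by simp
  also note deg
  also have "(3::nat) ^ (n - 1) < 3 ^ n"
    using n_pos by simp
  finally show False using card by simp
qed


lemma frob_mod: "(x::'a) ^ (3 ^ (m mod n)) = x ^ (3 ^ m)"
proof (induction m rule: less_induct)
  case (less m)
  show ?case
  proof (cases "m < n")
    case False
    have "(3::nat) ^ m = 3 ^ n * 3 ^ (m - n)"
      using False by (simp flip: power_add)
    then have "x ^ (3 ^ m) = (x ^ (3 ^ n)) ^ (3 ^ (m - n))"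
      by (simp only: power_mult)
    also have "\<dots> = x ^ (3 ^ ((m - n) mod n))"
      using less[of "m - n"] False n_pos by simp
    finally show ?thesis
      using False by (simp add: le_mod_geq)
  qed simp
qed

subsection \<open>Bases of additive subgroups\<close>

definition combo :: "'a list \<Rightarrow> gf3 vec \<Rightarrow> 'a" where
  "combo e c = (\<Sum>i<length e. of_gf3 (c $ i) * e ! i)"

lemma combo_add:
  assumes "c \<in> carrier_vec (length e)" "d \<in> carrier_vec (length e)"
  shows "combo e (c + d) = combo e c + combo e d"
  using assms by (simp add: combo_def of_gf3_add[OF char] algebra_simps sum.distrib)

lemma combo_diff:
  assumes "c \<in> carrier_vec (length e)" "d \<in> carrier_vec (length e)"
  shows "combo e (c - d) = combo e c - combo e d"
  using assms by (simp add: combo_def of_gf3_diff[OF char] algebra_simps sum_subtractf)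

lemma combo_smult:
  assumes "c \<in> carrier_vec (length e)"
  shows "combo e (t \<cdot>\<^sub>v c) = of_gf3 t * combo e c"
  using assms by (simp add: combo_def of_gf3_mult[OF char] mult_ac sum_distrib_left)

lemma combo_snoc: "combo (e @ [w]) c = combo e (vec (length e) (\<lambda>i. c $ i)) + of_gf3 (c $ length e) * w"
  by (simp add: combo_def nth_append)

text \<open>Scalars are 0, 1 and 2, and doubling is an addition, so an additive subgroup is already
  a subspace over the prime field.\<close>

lemma combo_in:
  assumes "0 \<in> W" "\<And>x y. x \<in> W \<Longrightarrow> y \<in> W \<Longrightarrow> x - y \<in> W" "set e \<subseteq> W"
  shows "combo e c \<in> W"
proof -
  have minus: "- x \<in> W" if "x \<in> W" for x
    using assms(2)[OF assms(1) that] by simp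
  have add: "x + y \<in> W" if "x \<in> W" "y \<in> W" for x y
    using assms(2)[OF that(1) minus[OF that(2)]] by simp
  have scale: "of_gf3 t * x \<in> W" if "x \<in> W" for t x
    using gf3_cases[of t]
  proof (elim disjE)
    assume "t = 2"
    then show ?thesis
      using add[OF that that] by (simp only: of_gf3_simps mult_2)
  qed (simp_all add: of_gf3_simps assms(1) that)
  have "(\<Sum>i\<in>I. of_gf3 (c $ i) * e ! i) \<in> W" if "I \<subseteq> {..<length e}" for I
    using that assms
    by (induction I rule: infinite_finite_induct) (auto intro!: add scale)
  then show ?thesis
    by (simp add: combo_def)
qed

text \<open>Independence is expressed as injectivity of \<open>combo\<close>. Counting bounds the
  length of independent lists by \<open>m\<close>; a longest one must span \<open>W\<close>, and
  counting again gives length \<open>m\<close>.\<close>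

lemma ex_basis:
  assumes W: "0 \<in> W" "\<And>x y. x \<in> W \<Longrightarrow> y \<in> W \<Longrightarrow> x - y \<in> W" and card_W: "card W = 3 ^ m"
  shows "\<exists>e. length e = m \<and> set e \<subseteq> W \<and> bij_betw (combo e) (carrier_vec m) W"
proof -
  define P where "P e \<longleftrightarrow> set e \<subseteq> W \<and> inj_on (combo e) (carrier_vec (length e))" for e
  have into: "combo e ` carrier_vec (length e) \<subseteq> W" if "P e" for e
    using that combo_in[OF W] by (auto simp: P_def)
  have "length e \<le> m" if "P e" for e
  proof -
    have "card (carrier_vec (length e) :: gf3 vec set) \<le> card W"
      using that into[OF that] by (intro card_inj_on_le[of "combo e"]) (auto simp: P_def)
    then show ?thesis
      by (simp add: card_carrier_vec card_W)
  qed
  then have bounded: "\<forall>e. P e \<longrightarrow> length e < Suc m"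
    by (simp add: less_Suc_eq_le)
  have "P []"
    by (auto simp: P_def intro!: inj_onI)
  from ex_has_greatest_nat[of P, OF this bounded] obtain e
    where e: "P e" and max: "\<And>e'. P e' \<Longrightarrow> length e' \<le> length e"
    by blast
  define l where "l = length e"
  have "combo e ` carrier_vec l = W"
  proof (rule ccontr)
    assume "combo e ` carrier_vec l \<noteq> W"
    then obtain w where w: "w \<in> W" "w \<notin> combo e ` carrier_vec l"
      using into[OF e] by (auto simp: l_def)
    have "inj_on (combo (e @ [w])) (carrier_vec (Suc l))"
    proof (rule inj_onI)
      fix c d :: "gf3 vec"
      assume cd: "c \<in> carrier_vec (Suc l)" "d \<in> carrier_vec (Suc l)"
        and eq: "combo (e @ [w]) c = combo (e @ [w]) d"
      define c' d' t where "c' = vec l (\<lambda>i. c $ i)" and "d' = vec l (\<lambda>i. d $ i)"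
        and "t = d $ l - c $ l"
      have carrier: "c' \<in> carrier_vec l" "d' \<in> carrier_vec l"
        by (auto simp: c'_def d'_def)
      have *: "combo e (c' - d') = of_gf3 t * w"
        using eq carrier
        by (simp add: combo_snoc combo_diff of_gf3_diff[OF char] algebra_simps
            flip: l_def c'_def d'_def t_def)
          (simp add: t_def of_gf3_diff[OF char] algebra_simps)
      \<comment> \<open>Since \<open>t * t = 1\<close> for nonzero \<open>t\<close>, scaling the
        relation by \<open>t\<close> would put \<open>w\<close> into the span of
        \<open>e\<close>.\<close>
      have "t = 0"
      proof (rule ccontr)
        assume t: "t \<noteq> 0"
        have "combo e (t \<cdot>\<^sub>v (c' - d')) = of_gf3 (t * t) * w"
          using carrier by (simp add: combo_smult * of_gf3_mult[OF char] flip: l_def)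
        then have "combo e (t \<cdot>\<^sub>v (c' - d')) = w"
          by (simp add: gf3_square[OF t] of_gf3_simps)
        moreover have "t \<cdot>\<^sub>v (c' - d') \<in> carrier_vec l"
          using carrier by simp
        ultimately show False
          using w(2) by blast
      qed
      then have "combo e c' = combo e d'"
        using * carrier by (simp add: combo_diff of_gf3_simps flip: l_def)
      then have "c' = d'"
        using e carrier by (auto simp: P_def l_def dest: inj_onD)
      then have "c $ i = d $ i" if "i < l" for i
        using that unfolding c'_def d'_def by (metis index_vec)
      with \<open>t = 0\<close> show "c = d"
        using cd by (intro eq_vecI) (auto simp: t_def less_Suc_eq)
    qed
    then have "P (e @ [w])"
      using e w by (simp add: P_def l_def)
    from max[OF this] show False
      by simp
  qed
  then have bij: "bij_betw (combo e) (carrier_vec l) W"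
    using e by (simp add: P_def bij_betw_def l_def)
  from bij_betw_same_card[OF this] have "l = m"
    by (simp add: card_carrier_vec card_W)
  with e bij show ?thesis
    by (auto simp: P_def l_def)
qed

end

section \<open>Decomposition of the quartic form\<close>

text \<open>The equation for \<open>a\<close> and the residue of \<open>k\<close> enter the argument
  only through these assumptions; the sign \<epsilon> merges the two cases.\<close>

locale quartic = ternary_field ty n for ty :: "'a::finite_field itself" and n +
  fixes k :: nat and \<epsilon> a\<^sub>1 a\<^sub>2 :: 'a and \<sigma> :: "'a \<Rightarrow> 'a"
  assumes n: "n = 4 * k"
    and \<sigma>_def: "\<And>x. \<sigma> x = x ^ (3 ^ k)"
    and \<epsilon>: "\<epsilon> = 1 \<or> \<epsilon> = - 1"
    and a\<^sub>1_neq_0: "a\<^sub>1 \<noteq> 0"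
    and a\<^sub>1_odd: "\<sigma> (\<sigma> a\<^sub>1) = - a\<^sub>1"
    and a\<^sub>2: "a\<^sub>2 = \<epsilon> * (a\<^sub>1 + \<sigma> a\<^sub>1)"
begin

text \<open>The exponents are \<open>2 * (3 ^ k + 1)\<close> and
  \<open>(3 ^ k + 1) ^ 2 = 1 + 2 * 3 ^ k + 3 ^ (2 * k)\<close>, written through conjugates.\<close>

definition f :: "'a \<Rightarrow> gf3" where
  "f x = Tr n (a\<^sub>1 * x\<^sup>2 * (\<sigma> x)\<^sup>2 + a\<^sub>2 * x * (\<sigma> x)\<^sup>2 * \<sigma> (\<sigma> x))"

text \<open>With \<epsilon> in the eigenvalues, the factor \<epsilon> of \<open>a\<^sub>2\<close>
  cancels in the expansion of \<open>f\<close>.\<close>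

definition U :: "'a set" where "U = {x. \<sigma> (\<sigma> x) = - \<epsilon> * x}"
definition V :: "'a set" where "V = {x. \<sigma> (\<sigma> x) = \<epsilon> * x}"

section \<open>The automorphism \<sigma> of order four and the trace\<close>

lemma \<sigma>_add: "\<sigma> (x + y) = \<sigma> x + \<sigma> y"
  by (simp add: \<sigma>_def frob_add)

lemma \<sigma>_diff: "\<sigma> (x - y) = \<sigma> x - \<sigma> y"
  by (simp add: \<sigma>_def frob_diff)

lemma \<sigma>_minus: "\<sigma> (- x) = - \<sigma> x"
  by (simp add: \<sigma>_def frob_minus)

lemma \<sigma>_mult: "\<sigma> (x * y) = \<sigma> x * \<sigma> y"
  by (simp add: \<sigma>_def power_mult_distrib)

lemma \<sigma>_power: "\<sigma> (x ^ m) = \<sigma> x ^ m"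
  by (simp add: \<sigma>_def power_mult[symmetric] mult.commute)

lemma \<sigma>_0 [simp]: "\<sigma> 0 = 0"
  by (simp add: \<sigma>_def)

lemma \<sigma>_\<epsilon>: "\<sigma> \<epsilon> = \<epsilon>"
  using \<epsilon> by (auto simp: \<sigma>_def frob_minus)

lemmas \<sigma>_simps = \<sigma>_add \<sigma>_diff \<sigma>_minus \<sigma>_mult \<sigma>_power \<sigma>_\<epsilon>

lemma \<epsilon>_square [simp]: "\<epsilon> * \<epsilon> = 1"
  using \<epsilon> by auto

lemma \<epsilon>_square' [simp]: "\<epsilon> * (\<epsilon> * x) = x"
  by (simp flip: mult.assoc)

lemma \<sigma>_4 [simp]: "\<sigma> (\<sigma> (\<sigma> (\<sigma> x))) = x"
proof -
  have "\<sigma> (\<sigma> (\<sigma> (\<sigma> x))) = x ^ (3 ^ k * 3 ^ k * 3 ^ k * 3 ^ k)"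
    by (simp add: \<sigma>_def power_mult)
  also have "3 ^ k * 3 ^ k * 3 ^ k * 3 ^ k = (3::nat) ^ n"
    by (simp add: n flip: power_add)
  finally show ?thesis
    by simp
qed

lemma \<sigma>_eq_0_iff [simp]: "\<sigma> x = 0 \<longleftrightarrow> x = 0"
  by (simp add: \<sigma>_def)

lemma Tr_\<sigma>: "Tr n (\<sigma> x) = Tr n x"
  by (simp add: \<sigma>_def Tr_frob)

text \<open>By invariance under \<sigma> the trace of \<open>x\<close> equals its own negative, and
  2 is invertible modulo 3.\<close>

lemma Tr_odd: "Tr n x = 0" if "\<sigma> (\<sigma> x) = - x"
  using Tr_\<sigma>[of "\<sigma> x"] that by (intro gf3_eq_minus_self) (simp add: Tr_\<sigma> Tr_minus)

lemma eq_minus_self: "x = 0" if "x = - x" for x :: 'a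
proof -
  have "3 * x = x + x + x"
    by (simp add: algebra_simps)
  also have "x + x = 0"
    using that by (metis add.right_inverse)
  finally show ?thesis
    by simp
qed

section \<open>The two eigenspaces, their projections and their size\<close>

lemma U_0: "0 \<in> U" and V_0: "0 \<in> V"
  by (simp_all add: U_def V_def)

lemma U_diff: "x \<in> U \<Longrightarrow> y \<in> U \<Longrightarrow> x - y \<in> U"
  by (simp add: U_def \<sigma>_simps algebra_simps)

lemma V_diff: "x \<in> V \<Longrightarrow> y \<in> V \<Longrightarrow> x - y \<in> V"
  by (simp add: V_def \<sigma>_simps algebra_simps)

text \<open>These are the eigenprojections of \<open>\<sigma> \<circ> \<sigma>\<close>, with the factor \<open>1 / 2 = - 1\<close> absorbed.\<close>

definition prU :: "'a \<Rightarrow> 'a" where "prU x = \<epsilon> * \<sigma> (\<sigma> x) - x"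
definition prV :: "'a \<Rightarrow> 'a" where "prV x = - x - \<epsilon> * \<sigma> (\<sigma> x)"

lemma prU_in: "prU x \<in> U" and prV_in: "prV x \<in> V"
  by (simp_all add: U_def V_def prU_def prV_def \<sigma>_simps algebra_simps)

lemma minus_two: "- x - x = (x :: 'a)"
proof -
  have "- x - x = x - 3 * x"
    by (simp add: algebra_simps)
  then show ?thesis
    by simp
qed

lemma prU_plus_prV: "prU x + prV x = x"
  using minus_two[of x] by (simp add: prU_def prV_def)

lemma prU_sum: "prU (u + v) = u" if "u \<in> U" "v \<in> V"
  using that minus_two[of u] by (simp add: U_def V_def prU_def \<sigma>_simps algebra_simps)

lemma prV_sum: "prV (u + v) = v" if "u \<in> U" "v \<in> V"
  using that minus_two[of v] by (simp add: U_def V_def prV_def \<sigma>_simps algebra_simps)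

lemma bij_UV: "bij_betw (\<lambda>(u, v). u + v) (U \<times> V) UNIV"
  by (rule bij_betw_byWitness[where f' = "\<lambda>x. (prU x, prV x)"])
    (auto simp: prU_in prV_in prU_plus_prV prU_sum prV_sum)

lemma card_U: "card U = 3 ^ (2 * k)" and card_V: "card V = 3 ^ (2 * k)"
proof -
  \<comment> \<open>Multiplication by \<open>a\<^sub>1\<close> exchanges the two eigenspaces, as \<open>\<sigma> (\<sigma> a\<^sub>1) = - a\<^sub>1\<close>.\<close>
  have "bij_betw ((*) a\<^sub>1) V U"
    using a\<^sub>1_neq_0 a\<^sub>1_odd
    by (intro bij_betw_byWitness[where f' = "\<lambda>x. x / a\<^sub>1"])
      (auto simp: U_def V_def \<sigma>_def power_divide power_mult_distrib divide_simps)
  then have UV: "card V = card U"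
    by (rule bij_betw_same_card)
  have "card U * card V = CARD('a)"
    using bij_betw_same_card[OF bij_UV] by (simp add: card_cartesian_product)
  then have "(card U)\<^sup>2 = (3 ^ (2 * k))\<^sup>2"
    by (simp add: UV card n power2_eq_square flip: power_add)
  then show "card U = 3 ^ (2 * k)"
    by (simp add: power2_eq_iff_nonneg)
  with UV show "card V = 3 ^ (2 * k)"
    by simp
qed

section \<open>The bijection between the eigenspaces\<close>

definition p :: "'a \<Rightarrow> 'a" where
  "p v = (a\<^sub>1 - \<sigma> a\<^sub>1) * v * (\<sigma> v)\<^sup>2"

text \<open>Two applications of \<sigma> negate \<open>a\<^sub>1 - \<sigma> a\<^sub>1\<close>,
  multiply \<open>v\<close> by \<epsilon> and fix the square of \<open>\<sigma> v\<close>.\<close>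

lemma p_in: "p v \<in> U" if "v \<in> V"
  using that \<epsilon> by (auto simp: p_def U_def V_def \<sigma>_simps a\<^sub>1_odd algebra_simps)

text \<open>For nonzero arguments, \<open>p v = p w\<close> and its image under \<sigma> make the
  ratios \<open>\<sigma> v / v\<close> and \<open>\<sigma> w / w\<close> equal; then
  \<open>v ^ 3 = w ^ 3\<close>, and cubing is injective in characteristic 3.\<close>

lemma inj_p: "inj_on p V"
proof (rule inj_onI)
  fix v w
  assume V: "v \<in> V" "w \<in> V" and eq: "p v = p w"
  \<comment> \<open>Otherwise \<sigma> would fix \<open>a\<^sub>1\<close>, forcing
    \<open>a\<^sub>1 = - a\<^sub>1\<close>.\<close>
  have "a\<^sub>1 - \<sigma> a\<^sub>1 \<noteq> 0"
    using a\<^sub>1_odd a\<^sub>1_neq_0 eq_minus_self[of a\<^sub>1] by auto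
  then have 1: "v * (\<sigma> v)\<^sup>2 = w * (\<sigma> w)\<^sup>2"
    using eq by (simp add: p_def)
  have sq: "(\<sigma> (\<sigma> x))\<^sup>2 = x\<^sup>2" if "x \<in> V" for x
    using that \<epsilon> by (auto simp: V_def)
  have 2: "\<sigma> v * v\<^sup>2 = \<sigma> w * w\<^sup>2"
    using arg_cong[OF 1, of \<sigma>] sq V by (simp add: \<sigma>_simps)
  show "v = w"
  proof (cases "v = 0")
    case True
    then show ?thesis
      using 1 by auto
  next
    case False
    have "w \<noteq> 0"
      using 1 False by auto
    \<comment> \<open>The common factor \<open>v * w * \<sigma> v * \<sigma> w\<close> is nonzero
      and cancels.\<close>
    have "(v * (\<sigma> v)\<^sup>2) * (\<sigma> w * w\<^sup>2) = (w * (\<sigma> w)\<^sup>2) * (\<sigma> v * v\<^sup>2)"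
      by (simp only: 1 2)
    then have 3: "\<sigma> v * w = v * \<sigma> w"
      using False \<open>w \<noteq> 0\<close> by (simp add: power2_eq_square)
    have "v ^ 3 * (\<sigma> w)\<^sup>2 = v * (v * \<sigma> w)\<^sup>2"
      by (simp add: power2_eq_square power3_eq_cube)
    also have "\<dots> = (v * (\<sigma> v)\<^sup>2) * w\<^sup>2"
      by (simp add: 3[symmetric] power_mult_distrib)
    also have "\<dots> = w ^ 3 * (\<sigma> w)\<^sup>2"
      unfolding 1 by (simp add: power2_eq_square power3_eq_cube)
    finally have "v ^ 3 - w ^ 3 = 0"
      using \<open>w \<noteq> 0\<close> by simp
    then have "(v - w) ^ 3 = 0"
      using frob_diff[of v w 1] by simp
    then show ?thesis
      by simp
  qed
qed

lemma bij_p: "bij_betw p V U"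
  unfolding bij_betw_def
proof
  show "p ` V = U"
    using p_in inj_p by (intro card_subset_eq) (auto simp: card_image card_U card_V)
qed (rule inj_p)

text \<open>Only \<open>p v * u\<close> survives the trace: \<open>W\<close> has trace 0 by
  \<open>Tr_odd\<close>, \<open>Z\<close> and \<open>\<sigma> Z\<close> have equal traces, and
  \<open>3 * R\<close> is zero.\<close>

lemma f_sum:
  assumes "u \<in> U" "v \<in> V"
  shows "f (u + v) = Tr n (p v * u)"
proof -
  \<comment> \<open>With these as atoms, \<sigma> acts by substitution up to sign and the expansions
    become polynomial identities.\<close>
  define u1 v1 A A1 where "u1 = \<sigma> u" and "v1 = \<sigma> v" and "A = a\<^sub>1" and "A1 = \<sigma> a\<^sub>1"
  have \<sigma>': "\<sigma> u = u1" "\<sigma> v = v1" "\<sigma> u1 = - \<epsilon> * u" "\<sigma> v1 = \<epsilon> * v" "\<sigma> A = A1" "\<sigma> A1 = - A"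
    using assms a\<^sub>1_odd by (simp_all add: u1_def v1_def A_def A1_def U_def V_def)
  have sq: "(\<epsilon> * x)\<^sup>2 = x\<^sup>2" for x
    by (simp add: power_mult_distrib power2_eq_square[of \<epsilon>])
  \<comment> \<open>\<open>W\<close> is negated by \<open>\<sigma> \<circ> \<sigma>\<close>, and \<open>3 * R\<close> makes the expansion an identity over the integers.\<close>
  define W where "W = A * ((u\<^sup>2 + v\<^sup>2) * (u1\<^sup>2 + v1\<^sup>2) + (u * v + u * v) * (u1 * v1 + u1 * v1))
    + (A + A1) * (v\<^sup>2 - u\<^sup>2) * (u1\<^sup>2 + v1\<^sup>2)"
  define Z where "Z = A * u * v * v1\<^sup>2 + A1 * u * v * v1\<^sup>2 - A * u * v * u1\<^sup>2"
  define R where "R = A * u * v * u1\<^sup>2 - A1 * u\<^sup>2 * u1 * v1 + (A + A1) * v\<^sup>2 * u1 * v1"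
  have \<sigma>Z: "\<sigma> Z = A1 * u1 * v1 * v\<^sup>2 - A * u1 * v1 * v\<^sup>2 - A1 * u1 * v1 * u\<^sup>2"
    by (simp add: Z_def \<sigma>_simps \<sigma>' sq)
  have \<sigma>2: "\<sigma> (\<sigma> (u + v)) = \<epsilon> * (v - u)"
    by (simp add: \<sigma>_simps \<sigma>' algebra_simps)
  have "a\<^sub>1 * (u + v)\<^sup>2 * (\<sigma> (u + v))\<^sup>2 + a\<^sub>2 * (u + v) * (\<sigma> (u + v))\<^sup>2 * \<sigma> (\<sigma> (u + v))
      = A * (u + v)\<^sup>2 * (u1 + v1)\<^sup>2 + (A + A1) * (u + v) * (u1 + v1)\<^sup>2 * (v - u)"
    unfolding a\<^sub>2 \<sigma>2 unfolding \<sigma>_add \<sigma>' A_def[symmetric] by (simp add: mult_ac)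
  also have "\<dots> = W + (A - A1) * v * v1\<^sup>2 * u + (Z - \<sigma> Z) + 3 * R"
    unfolding W_def R_def Z_def \<sigma>Z[unfolded Z_def] by (simp add: algebra_simps power2_eq_square del: three_0)
  finally have expand: "a\<^sub>1 * (u + v)\<^sup>2 * (\<sigma> (u + v))\<^sup>2 + a\<^sub>2 * (u + v) * (\<sigma> (u + v))\<^sup>2 * \<sigma> (\<sigma> (u + v))
      = W + p v * u + (Z - \<sigma> Z) + 3 * R"
    by (simp add: p_def A_def A1_def v1_def)
  \<comment> \<open>\<open>W'\<close> is the image of \<open>W\<close> under \<sigma>, written out
    so that each of the two applications is a single substitution.\<close>
  define W' where "W' = A1 * ((u\<^sup>2 + v\<^sup>2) * (u1\<^sup>2 + v1\<^sup>2) - (u * v + u * v) * (u1 * v1 + u1 * v1))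
    + (A1 - A) * (v1\<^sup>2 - u1\<^sup>2) * (u\<^sup>2 + v\<^sup>2)"
  have sq': "(- \<epsilon> * x)\<^sup>2 = x\<^sup>2" and cross: "(- \<epsilon> * x) * (\<epsilon> * y) = - (x * y)" for x y
    using sq[of x] by (simp_all add: mult_ac)
  note \<sigma>_expand = \<sigma>_add \<sigma>_diff \<sigma>_mult \<sigma>_power \<sigma>' sq sq' cross
  have "\<sigma> W = W'"
    by (simp only: W_def W'_def \<sigma>_expand) (simp add: algebra_simps)
  moreover have "\<sigma> W' = - W"
    by (simp only: W_def W'_def \<sigma>_expand) (simp add: algebra_simps)
  ultimately have "\<sigma> (\<sigma> W) = - W"
    by simp
  then show ?thesis
    by (simp only: f_def expand Tr_add Tr_diff Tr_\<sigma> Tr_odd three_0) simp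
qed


subsection \<open>Bentness\<close>

text \<open>Some multiple \<open>d * y\<close> has nonzero trace. The product of \<open>d\<close>
  with the \<open>V\<close> component of \<open>y\<close> is negated by two applications of
  \<sigma>, so the \<open>U\<close> component accounts for that trace.\<close>

lemma Tr_nondegenerate: "d = 0" if d: "d \<in> U" and Tr: "\<And>u. u \<in> U \<Longrightarrow> Tr n (d * u) = 0"
proof (rule ccontr)
  assume "d \<noteq> 0"
  obtain x :: 'a where x: "Tr n x \<noteq> 0"
    using Tr_nonzero by blast
  define y where "y = x / d"
  have "\<sigma> (\<sigma> (d * prV y)) = - (d * prV y)"
    using d prV_in[of y] by (simp add: U_def V_def \<sigma>_simps mult_ac)
  then have "Tr n (d * prV y) = 0"
    by (rule Tr_odd)
  moreover have "Tr n (d * prU y) = 0"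
    by (rule Tr[OF prU_in])
  ultimately have "Tr n (d * (prU y + prV y)) = 0"
    by (simp add: distrib_left Tr_add)
  then show False
    using x \<open>d \<noteq> 0\<close> by (simp add: prU_plus_prV y_def)
qed

text \<open>Orthogonality of characters: for nonzero \<open>d\<close>, translating the summation
  variable by a suitable \<open>w\<close> multiplies the sum by a factor other than 1.\<close>

lemma character_sum:
  assumes d: "d \<in> U"
  shows "(\<Sum>u\<in>U. omega_pow (Tr n (d * u))) = (if d = 0 then 3 ^ (2 * k) else 0)"
proof (cases "d = 0")
  case True
  then show ?thesis
    by (simp add: card_U)
next
  case False
  then obtain w where w: "w \<in> U" "Tr n (d * w) \<noteq> 0"
    using Tr_nondegenerate[OF d] by blast
  define S where "S = (\<Sum>u\<in>U. omega_pow (Tr n (d * u)))"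
  have minus: "- x \<in> U" if "x \<in> U" for x
    using U_diff[OF U_0 that] by simp
  have "S = (\<Sum>u\<in>U. omega_pow (Tr n (d * (u + w))))"
    unfolding S_def
    using w(1) U_diff U_diff[OF _ minus[OF w(1)]]
    by (intro sum.reindex_bij_witness[of _ "\<lambda>u. u + w" "\<lambda>u. u - w"]) auto
  also have "\<dots> = S * omega_pow (Tr n (d * w))"
    by (simp add: S_def distrib_left Tr_add omega_pow_add sum_distrib_right)
  finally have "S = 0"
    using omega_pow_neq_1[OF w(2)] by simp
  then show ?thesis
    using False by (simp add: S_def)
qed

text \<open>Summing over \<open>u\<close> first gives a character sum with parameter
  \<open>p v - prU b\<close>, which vanishes unless \<open>v\<close> is the unique preimage of
  \<open>prU b\<close> under \<open>p\<close>.\<close>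

lemma walsh_f: "\<exists>v\<in>V. walsh n f b = 3 ^ (2 * k) * omega_pow (- Tr n (b * v))"
proof -
  obtain w where w: "w \<in> V" "p w = prU b"
    using bij_p prU_in[of b] unfolding bij_betw_def by (metis imageE)
  have eq_w: "p v = prU b \<longleftrightarrow> v = w" if "v \<in> V" for v
    using inj_p w that by (metis inj_onD)
  have inner: "(\<Sum>u\<in>U. omega_pow (f (u + v) - Tr n (b * (u + v))))
      = (if v = w then 3 ^ (2 * k) * omega_pow (- Tr n (b * w)) else 0)" if v: "v \<in> V" for v
  proof -
    have "omega_pow (f (u + v) - Tr n (b * (u + v)))
        = omega_pow (- Tr n (b * v)) * omega_pow (Tr n ((p v - prU b) * u))" if u: "u \<in> U" for u
    proof -
      \<comment> \<open>The \<open>V\<close> component of \<open>b\<close> pairs trivially with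
        \<open>U\<close>, so only \<open>prU b\<close> enters the character in
        \<open>u\<close>.\<close>
      have "\<sigma> (\<sigma> (prV b * u)) = - (prV b * u)"
        using u prV_in[of b] by (simp add: U_def V_def \<sigma>_simps mult_ac)
      then have "Tr n (prV b * u) = 0"
        by (rule Tr_odd)
      moreover have "Tr n (b * u) = Tr n (prU b * u) + Tr n (prV b * u)"
        by (simp add: prU_plus_prV flip: Tr_add distrib_right)
      ultimately have "f (u + v) - Tr n (b * (u + v))
          = - Tr n (b * v) + Tr n ((p v - prU b) * u)"
        by (simp add: f_sum[OF u v] left_diff_distrib distrib_left Tr_add Tr_diff)
      then show ?thesis
        by (simp only: omega_pow_add)
    qed
    then have "(\<Sum>u\<in>U. omega_pow (f (u + v) - Tr n (b * (u + v))))
        = omega_pow (- Tr n (b * v)) * (\<Sum>u\<in>U. omega_pow (Tr n ((p v - prU b) * u)))"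
      by (simp add: sum_distrib_left)
    also have "\<dots> = (if v = w then 3 ^ (2 * k) * omega_pow (- Tr n (b * w)) else 0)"
      using character_sum[OF U_diff[OF p_in[OF v] prU_in[of b]]] eq_w[OF v] by simp
    finally show ?thesis .
  qed
  have "walsh n f b = (\<Sum>(u, v)\<in>U \<times> V. omega_pow (f (u + v) - Tr n (b * (u + v))))"
    unfolding walsh_def using sum.reindex_bij_betw[OF bij_UV, symmetric]
    by (simp add: case_prod_unfold)
  also have "\<dots> = (\<Sum>v\<in>V. \<Sum>u\<in>U. omega_pow (f (u + v) - Tr n (b * (u + v))))"
    by (subst sum.swap) (simp add: sum.cartesian_product)
  also have "\<dots> = 3 ^ (2 * k) * omega_pow (- Tr n (b * w))"
    using w(1) by (simp add: inner)
  finally show ?thesis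
    using w(1) by blast
qed

lemma bent_f: "bent n f"
  unfolding bent_def
proof
  fix b :: 'a
  have "cmod (walsh n f b) = 3 ^ (2 * k)"
    using walsh_f[of b] by (auto simp: norm_mult norm_power)
  then show "(cmod (walsh n f b))\<^sup>2 = 3 ^ n"
    by (simp add: n power2_eq_square flip: power_add)
qed

lemma regular_bent_f: "regular_bent n f"
  unfolding regular_bent_def
proof (intro conjI allI bent_f)
  fix b :: 'a
  have "(3::real) powr (- real n / 2) = inverse (3 powr real (2 * k))"
    by (simp add: n powr_minus)
  also have "\<dots> = inverse (3 ^ (2 * k))"
    by (subst powr_realpow) simp_all
  finally show "\<exists>c. of_real (3 powr (- real n / 2)) * walsh n f b = omega_pow c"
    using walsh_f[of b] by (auto simp flip: mult.assoc)
qed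

subsection \<open>Algebraic degree\<close>

text \<open>The zero function has Walsh value \<open>3 ^ n\<close> at 0, whose squared modulus is
  too large for a bent function.\<close>

lemma f_nonzero: "\<exists>x. f x \<noteq> 0"
proof (rule ccontr)
  assume "\<not> ?thesis"
  then have "walsh n f 0 = 3 ^ n"
    by (simp add: walsh_def card)
  then have "cmod (walsh n f 0) = 3 ^ n"
    by (simp add: norm_power)
  moreover have "(cmod (walsh n f 0))\<^sup>2 = 3 ^ n"
    using bent_f by (simp add: bent_def)
  ultimately have "(3::real) ^ n * 3 ^ n = 3 ^ n"
    by (simp only: power2_eq_square)
  then show False
    using one_less_power[of "3::real" n] n_pos by simp
qed

text \<open>Writing out the trace gives the reduced representation \<open>q\<close>, by uniqueness;
  every exponent occurring in it has digit sum 4.\<close>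

lemma algebraic_degree_f: "algebraic_degree f = 4"
proof -
  \<comment> \<open>Reduction modulo \<open>n\<close> reflects \<open>x ^ (3 ^ n) = x\<close> and
    keeps the exponents below \<open>3 ^ n\<close>.\<close>
  define e1 where "e1 i = exponent i ((i + k) mod n) i" for i
  define e2 where "e2 i = exponent i ((i + k) mod n) ((i + 2 * k) mod n)" for i
  define q where "q = (\<Sum>i<n. monom (a\<^sub>1 ^ 3 ^ i) (e1 i) + monom (a\<^sub>2 ^ 3 ^ i) (e2 i))"
  have k: "k > 0"
    using n_pos n by simp
  \<comment> \<open>A shift by \<open>k\<close> is nontrivial modulo \<open>4 * k\<close>, so the
    digit 2 at the middle position meets no other digit.\<close>
  have shift: "(i + k) mod n \<noteq> i" "(i + k) mod n \<noteq> (i + 2 * k) mod n" if "i < n" for i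
    using that k by (auto simp: n mod_if le_mod_geq)
  have e: "ternary_digit_sum (e1 i) = 4" "e1 i < 3 ^ n"
    "ternary_digit_sum (e2 i) = 4" "e2 i < 3 ^ n" if "i < n" for i
    using that n_pos shift[OF that] unfolding e1_def e2_def
    by (simp_all add: ternary_digit_sum_exponent[of _ n] exponent_less)
  have \<sigma>_frob: "(\<sigma> x) ^ 3 ^ i = x ^ 3 ^ (i + k)" for x i
    by (simp add: \<sigma>_def power_add mult.commute flip: power_mult)
  have swap: "(x\<^sup>2) ^ j = (x ^ j)\<^sup>2" for x :: 'a and j
    by (simp add: mult.commute flip: power_mult)
  have x_exponent: "x ^ exponent i j l = x ^ 3 ^ i * (x ^ 3 ^ j)\<^sup>2 * x ^ 3 ^ l" for x :: 'a and i j l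
    by (simp add: exponent_def power_add mult.commute[of 2] power_mult)
  have x_e1: "x ^ e1 i = (x\<^sup>2 * (\<sigma> x)\<^sup>2) ^ 3 ^ i" for x i
    unfolding e1_def x_exponent frob_mod power_mult_distrib swap \<sigma>_frob
    by (simp add: power2_eq_square mult_ac)
  have x_e2: "x ^ e2 i = (x * (\<sigma> x)\<^sup>2 * \<sigma> (\<sigma> x)) ^ 3 ^ i" for x i
    unfolding e2_def x_exponent frob_mod power_mult_distrib swap \<sigma>_frob
    by (simp add: mult_2 add.assoc)
  have poly_q: "poly q x = of_gf3 (f x)" for x
    unfolding q_def f_def of_gf3_Tr[OF card] poly_sum
    by (simp add: poly_monom x_e1 x_e2 frob_add power_mult_distrib mult.assoc)
  have e_le: "e1 i \<le> 3 ^ n - 1" "e2 i \<le> 3 ^ n - 1" if "i < n" for i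
    using e[OF that] by linarith+
  have deg_q: "degree q \<le> 3 ^ n - 1"
    unfolding q_def
    using e_le by (intro degree_sum_le degree_add_le)
      (auto intro!: order.trans[OF degree_monom_le])
  then have "degree q < CARD('a)"
    using card by (simp add: le_diff_conv2 less_eq_Suc_le)
  then have rep: "univariate_rep f = q"
    using univariate_rep[of f] poly_q by (intro poly_eqI_degree[where A = UNIV]) auto
  have "ternary_digit_sum j = 4" if j: "coeff q j \<noteq> 0" for j
  proof -
    have "\<exists>i<n. coeff (monom (a\<^sub>1 ^ 3 ^ i) (e1 i) + monom (a\<^sub>2 ^ 3 ^ i) (e2 i)) j \<noteq> 0"
      using j unfolding q_def coeff_sum by (metis (no_types, lifting) lessThan_iff sum.neutral)
    then obtain i where "i < n" "j = e1 i \<or> j = e2 i"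
      by (auto split: if_splits)
    then show ?thesis
      using e by blast
  qed
  \<comment> \<open>A nonzero coefficient comes from \<open>f_nonzero\<close>, without comparing the
    exponents for coincidences.\<close>
  moreover have "q \<noteq> 0"
    using f_nonzero poly_q by (metis of_gf3_inject of_gf3_simps(1) poly_0)
  then have "\<exists>j. coeff q j \<noteq> 0"
    by (metis leading_coeff_neq_0)
  ultimately have "ternary_digit_sum ` {j. coeff q j \<noteq> 0} = {4}"
    by force
  then show ?thesis
    by (simp add: algebraic_degree_def rep)
qed

subsection \<open>Membership in the Maiorana--McFarland class\<close>

text \<open>Coordinates in bases of \<open>U\<close> and \<open>V\<close> give the identification;
  there the trace pairing becomes a dot product, and \<open>g\<close> is zero.\<close>

lemma in_MM_class_f: "in_MM_class (2 * k) f"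
proof -
  define m where "m = 2 * k"
  obtain e where e: "length e = m" "set e \<subseteq> U" "bij_betw (combo e) (carrier_vec m) U"
    using ex_basis[OF U_0 U_diff card_U] by (auto simp: m_def)
  obtain e' where e': "length e' = m" "set e' \<subseteq> V" "bij_betw (combo e') (carrier_vec m) V"
    using ex_basis[OF V_0 V_diff card_V] by (auto simp: m_def)
  define \<alpha> where "\<alpha> = inv_into (carrier_vec m) (combo e)"
  define \<beta> where "\<beta> = inv_into (carrier_vec m) (combo e')"
  define \<phi> where "\<phi> x = (\<alpha> (prU x), \<beta> (prV x))" for x
  \<comment> \<open>The values on the basis \<open>e\<close> of the functional on \<open>U\<close>
    given by the trace pairing with \<open>p (combo e' y)\<close>.\<close>
  define \<pi> where "\<pi> y = vec m (\<lambda>i. Tr n (p (combo e' y) * e ! i))" for y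
  define h where "h = (\<lambda>(x, y). x \<bullet> \<pi> y)"
  have \<alpha>: "\<alpha> u \<in> carrier_vec m" "combo e (\<alpha> u) = u" if "u \<in> U" for u
    using e(3) that unfolding \<alpha>_def bij_betw_def by (auto intro: inv_into_into f_inv_into_f)
  have \<beta>: "\<beta> v \<in> carrier_vec m" "combo e' (\<beta> v) = v" if "v \<in> V" for v
    using e'(3) that unfolding \<beta>_def bij_betw_def by (auto intro: inv_into_into f_inv_into_f)
  have \<alpha>': "\<alpha> (combo e c) = c" if "c \<in> carrier_vec m" for c
    using e(3) that by (simp add: \<alpha>_def bij_betw_def)
  have \<beta>': "\<beta> (combo e' c) = c" if "c \<in> carrier_vec m" for c
    using e'(3) that by (simp add: \<beta>_def bij_betw_def)
  have combo: "combo e c \<in> U" "combo e' c \<in> V" if "c \<in> carrier_vec m" for c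
    using e(3) e'(3) that by (auto simp: bij_betw_def)
  have "bij_betw \<phi> UNIV (carrier_vec m \<times> carrier_vec m)"
    by (rule bij_betw_byWitness[where f' = "\<lambda>(c, d). combo e c + combo e' d"])
      (auto simp: \<phi>_def prU_in prV_in \<alpha> \<beta> \<alpha>' \<beta>' combo prU_plus_prV prU_sum prV_sum)
  moreover have "\<phi> (x + y) = (fst (\<phi> x) + fst (\<phi> y), snd (\<phi> x) + snd (\<phi> y))" for x y
  proof -
    \<comment> \<open>Additivity is verified in the field; applying \<alpha> and \<beta>, the
      inverses of the two \<open>combo\<close> maps, transfers it to coordinates.\<close>
    have "prU (x + y) = combo e (\<alpha> (prU x) + \<alpha> (prU y))"
      by (simp add: combo_add \<alpha> prU_in e(1)) (simp add: prU_def \<sigma>_simps algebra_simps)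
    moreover have "prV (x + y) = combo e' (\<beta> (prV x) + \<beta> (prV y))"
      by (simp add: combo_add \<beta> prV_in e'(1)) (simp add: prV_def \<sigma>_simps algebra_simps)
    ultimately show ?thesis
      by (simp add: \<phi>_def \<alpha>' \<beta>' \<alpha> \<beta> prU_in prV_in)
  qed
  moreover have "\<phi> (of_gf3 c * x) = (c \<cdot>\<^sub>v fst (\<phi> x), c \<cdot>\<^sub>v snd (\<phi> x))" for c x
  proof -
    have \<sigma>_c: "\<sigma> (of_gf3 c) = of_gf3 c"
      by (simp add: \<sigma>_def frob_of_gf3)
    have "prU (of_gf3 c * x) = combo e (c \<cdot>\<^sub>v \<alpha> (prU x))"
      by (simp add: combo_smult \<alpha> prU_in e(1)) (simp add: prU_def \<sigma>_simps \<sigma>_c algebra_simps)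
    moreover have "prV (of_gf3 c * x) = combo e' (c \<cdot>\<^sub>v \<beta> (prV x))"
      by (simp add: combo_smult \<beta> prV_in e'(1)) (simp add: prV_def \<sigma>_simps \<sigma>_c algebra_simps)
    ultimately show ?thesis
      by (simp add: \<phi>_def \<alpha>' \<beta>' \<alpha> \<beta> prU_in prV_in)
  qed
  ultimately have "gf3_linear_identification m \<phi>"
    by (simp add: gf3_linear_identification_def)
  moreover have Tr_combo: "Tr n (w * combo e c) = c \<bullet> vec m (\<lambda>i. Tr n (w * e ! i))" for w c
  proof -
    have "Tr n (w * combo e c) = (\<Sum>i<m. Tr n (of_gf3 (c $ i) * (w * e ! i)))"
      by (simp add: combo_def sum_distrib_left Tr_sum e(1) mult_ac)
    then show ?thesis
      by (simp add: Tr_scale scalar_prod_def lessThan_atLeast0)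
  qed
  have "inj_on \<pi> (carrier_vec m)"
  proof (rule inj_onI)
    fix y z
    assume yz: "y \<in> carrier_vec m" "z \<in> carrier_vec m" and eq: "\<pi> y = \<pi> z"
    define d where "d = p (combo e' y) - p (combo e' z)"
    have "d \<in> U"
      unfolding d_def by (intro U_diff p_in combo yz)
    moreover have "Tr n (d * u) = 0" if "u \<in> U" for u
    proof -
      \<comment> \<open>The pairing with \<open>u\<close> depends on \<open>w\<close> only through
        the values on the basis, and these agree for the two images under \<open>p\<close>.\<close>
      have "Tr n (w * u) = \<alpha> u \<bullet> vec m (\<lambda>i. Tr n (w * e ! i))" for w
        using Tr_combo[of w "\<alpha> u"] \<alpha>[OF that] by simp
      then show ?thesis
        using eq by (simp add: d_def left_diff_distrib Tr_diff \<pi>_def)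
    qed
    ultimately have "d = 0"
      by (rule Tr_nondegenerate)
    then have "combo e' y = combo e' z"
      using inj_onD[OF inj_p] combo(2) yz by (simp add: d_def)
    then show "y = z"
      using \<beta>' yz by metis
  qed
  then have "bij_betw \<pi> (carrier_vec m) (carrier_vec m)"
    unfolding bij_betw_def by (intro conjI endo_inj_surj finite_carrier_vec) (auto simp: \<pi>_def)
  then have "MM_function m h"
    unfolding MM_function_def by (intro exI[of _ \<pi>] exI[of _ "\<lambda>_. 0"]) (simp add: h_def)
  moreover have "f x = h (\<phi> x)" for x
  proof -
    have "f x = Tr n (p (prV x) * prU x)"
      using f_sum[OF prU_in prV_in, of x x] by (simp add: prU_plus_prV)
    also have "\<dots> = h (\<phi> x)"
      using Tr_combo[of "p (prV x)" "\<alpha> (prU x)"]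
      by (simp add: h_def \<phi>_def \<pi>_def \<alpha> \<beta> prU_in prV_in)
    finally show ?thesis .
  qed
  ultimately show ?thesis
    unfolding in_MM_class_def m_def by blast
qed

end

section \<open>Arithmetic of \<open>a\<close> and reduction to the quartic setting\<close>

theorem theorem5:
  fixes k n :: nat
    and a a\<^sub>1 a\<^sub>2 :: "'a::finite_field"
    and f :: "'a \<Rightarrow> gf3"
  assumes "n = 4 * k"
    and "odd k"
    and "CARD('a) = 3 ^ n"
    and "a \<in> GF3_subfield 4"
    and "a ^ 4 - a ^ 2 - 1 = 0"
    and "k mod 4 = 1 \<longrightarrow> a\<^sub>1 = a \<and> a\<^sub>2 = a ^ 5"
    and "k mod 4 = 3 \<longrightarrow> a\<^sub>1 = a ^ 5 \<and> a\<^sub>2 = a"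
    and "\<And>x. f x = Tr n (a\<^sub>1 * x ^ (2 * (3 ^ k + 1)) + a\<^sub>2 * x ^ ((3 ^ k + 1) ^ 2))"
  shows "regular_bent n f \<and> algebraic_degree f = 4 \<and> in_MM_class (2 * k) f"
proof -
  interpret ternary_field "TYPE('a)" n
    by standard (rule assms(3))
  define \<epsilon> :: 'a where "\<epsilon> = (if k mod 4 = 1 then 1 else - 1)"
  define \<sigma> where "\<sigma> x = x ^ (3 ^ k)" for x :: 'a
  have a4: "a ^ 4 = a\<^sup>2 + 1"
    using assms(5) by (simp add: algebra_simps)
  \<comment> \<open>Hence exponents of \<open>a\<close> count only modulo 16, which makes the action
    of \<sigma> on \<open>a\<close> computable.\<close>
  have a8: "a ^ 8 = - 1"
  proof -
    have "a ^ 8 = (a ^ 4) ^ 2"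
      by (simp flip: power_mult)
    also have "\<dots> = (a\<^sup>2 + 1) ^ 2"
      unfolding a4 ..
    also have "\<dots> = a ^ 4 + 2 * a\<^sup>2 + 1"
      by (simp add: power2_eq_square power4_eq_xxxx algebra_simps)
    also have "\<dots> = 3 * (a\<^sup>2 + 1) - 1"
      unfolding a4 by (simp add: algebra_simps del: three_0)
    finally show ?thesis
      by simp
  qed
  have a_add_8: "a ^ (m + 8) = - (a ^ m)" for m
    by (simp add: power_add a8)
  have a_16: "a ^ (16 * j) = 1" for j
    using a_add_8[of 8] a8 by (simp add: power_mult)
  have a_mod_16: "a ^ m = a ^ (m mod 16)" for m
  proof -
    have "a ^ m = a ^ (16 * (m div 16) + m mod 16)"
      by simp
    then show ?thesis
      unfolding power_add a_16 by simp
  qed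
  have \<sigma>_power: "\<sigma> (x ^ m) = \<sigma> x ^ m" for x m
    by (simp add: \<sigma>_def power_mult[symmetric] mult.commute)
  have a_neq_0: "a \<noteq> 0"
    using a8 by auto
  have "quartic n k \<epsilon> a\<^sub>1 a\<^sub>2 \<sigma>"
  proof (cases "k mod 4 = 1")
    case True
    \<comment> \<open>\<open>3 ^ 4 = 81\<close> is 1 modulo 16, so this residue depends only on
      \<open>k mod 4\<close>.\<close>
    have "(3::nat) ^ k mod 16 = 3 ^ (4 * (k div 4) + 1) mod 16"
      using mult_div_mod_eq[of 4 k] by (simp add: True)
    also have "\<dots> = ((3 ^ 4) ^ (k div 4) mod 16) * 3 mod 16"
      by (simp add: power_mult mod_mult_right_eq mult_ac)
    also have "((3::nat) ^ 4) ^ (k div 4) mod 16 = ((3 ^ 4) mod 16) ^ (k div 4) mod 16"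
      by (simp only: power_mod)
    finally have "(3::nat) ^ k mod 16 = 3"
      by simp
    then have \<sigma>_a: "\<sigma> a = a ^ 3"
      using a_mod_16[of "3 ^ k"] by (simp add: \<sigma>_def)
    show ?thesis
    proof
      show "\<epsilon> = 1 \<or> \<epsilon> = - 1" by (simp add: \<epsilon>_def)
      have a12: "a\<^sub>1 = a" "a\<^sub>2 = a ^ 5" "\<epsilon> = 1"
        using assms(6) True by (simp_all add: \<epsilon>_def)
      show "a\<^sub>1 \<noteq> 0"
        by (simp add: a12 a_neq_0)
      show "\<sigma> (\<sigma> a\<^sub>1) = - a\<^sub>1"
        using a_add_8[of 1] by (simp add: a12 \<sigma>_a \<sigma>_power flip: power_mult)
      \<comment> \<open>By the equation for \<open>a\<close> this is
        \<open>a * (a ^ 2 + 1) = a ^ 3 + a\<close>.\<close>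
      have "a ^ 5 = a * a ^ 4"
        by (simp flip: power_Suc)
      then show "a\<^sub>2 = \<epsilon> * (a\<^sub>1 + \<sigma> a\<^sub>1)"
        by (simp add: a12 \<sigma>_a a4 power2_eq_square power3_eq_cube algebra_simps)
    qed (simp_all add: assms(1) \<sigma>_def)
  next
    case False
    have k3: "k mod 4 = 3"
      using False \<open>odd k\<close> by presburger
    have "(3::nat) ^ k mod 16 = 3 ^ (4 * (k div 4) + 3) mod 16"
      using mult_div_mod_eq[of 4 k] by (simp add: k3)
    also have "\<dots> = ((3 ^ 4) ^ (k div 4) mod 16) * 27 mod 16"
      by (simp add: power_mult power_add mod_mult_right_eq mult_ac)
    also have "((3::nat) ^ 4) ^ (k div 4) mod 16 = ((3 ^ 4) mod 16) ^ (k div 4) mod 16"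
      by (simp only: power_mod)
    finally have "(3::nat) ^ k mod 16 = 11"
      by simp
    then have \<sigma>_a: "\<sigma> a = a ^ 11"
      using a_mod_16[of "3 ^ k"] by (simp add: \<sigma>_def)
    show ?thesis
    proof
      show "\<epsilon> = 1 \<or> \<epsilon> = - 1" by (simp add: \<epsilon>_def)
      have a12: "a\<^sub>1 = a ^ 5" "a\<^sub>2 = a" "\<epsilon> = - 1"
        using assms(7) k3 by (simp_all add: \<epsilon>_def)
      show "a\<^sub>1 \<noteq> 0"
        by (simp add: a12 a_neq_0)
      \<comment> \<open>\<open>5 * 11 = 55\<close> is 7 modulo 16.\<close>
      have \<sigma>_a1: "\<sigma> a\<^sub>1 = a ^ 7"
        using a_mod_16[of 55] by (simp add: a12 \<sigma>_a \<sigma>_power flip: power_mult)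
      \<comment> \<open>\<open>7 * 11 = 77\<close> is \<open>5 + 8\<close> modulo 16, and eight
        extra factors change the sign.\<close>
      show "\<sigma> (\<sigma> a\<^sub>1) = - a\<^sub>1"
        using a_mod_16[of 77] a_add_8[of 5]
        by (simp add: \<sigma>_a1) (simp add: a12 \<sigma>_a \<sigma>_power flip: power_mult)
      have "a ^ 5 + a ^ 7 = a ^ 5 * a ^ 4"
        unfolding a4 by (simp add: algebra_simps flip: power_add)
      also have "\<dots> = - a"
        using a_add_8[of 1] by (simp flip: power_add)
      finally show "a\<^sub>2 = \<epsilon> * (a\<^sub>1 + \<sigma> a\<^sub>1)"
        by (simp add: \<sigma>_a1) (simp add: a12)
    qed (simp_all add: assms(1) \<sigma>_def)
  qed
  then interpret Q: quartic "TYPE('a)" n k \<epsilon> a\<^sub>1 a\<^sub>2 \<sigma> .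
  have "f = Q.f"
  proof
    fix x
    have "x ^ (2 * (3 ^ k + 1)) = x\<^sup>2 * (\<sigma> x)\<^sup>2"
    proof -
      have "2 * (3 ^ k + 1) = 2 + 3 ^ k * (2::nat)"
        by simp
      then show ?thesis
        by (simp only: \<sigma>_def power_add power_mult)
    qed
    moreover have "x ^ ((3 ^ k + 1)\<^sup>2) = x * (\<sigma> x)\<^sup>2 * \<sigma> (\<sigma> x)"
      by (simp add: \<sigma>_def power2_eq_square power_add algebra_simps flip: power_mult)
    ultimately show "f x = Q.f x"
      by (simp add: assms(8) Q.f_def mult_ac)
  qed
  then show ?thesis
    using Q.regular_bent_f Q.algebraic_degree_f Q.in_MM_class_f by simp
qed

end
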